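(* If $(P,\mathcal{L})$ is an $r$-uniform linear system with $\nu_2(P,\mathcal{L})-1\leq r$, then $$\lceil \nu_2(P,\mathcal{L})/2\rceil\leq \frac{|P|+|\mathcal{L}|}{r+1}.$$
   Context: A linear system is a pair $(P,\mathcal{L})$ where $P$ is a finite set (points) and $\mathcal{L}$ is a family of subsets of $P$ (lines) such that $|l\cap l'|\leq 1$ for all distinct $l,l'\in\mathcal{L}$; it is $r$-uniform if every line has exactly $r$ points. A 2-packing is a set $R\subseteq\mathcal{L}$ such that no three lines of $R$ have a common point; $\nu_2(P,\mathcal{L})$ is the maximum size of a 2-packing. *)

theory Defs
  imports Complex_Main
begin

definition linear_system :: "'a set \<Rightarrow> 'a set set \<Rightarrow> bool" where
  "linear_system P L \<longleftrightarrow>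
     finite P \<and> L \<subseteq> Pow P \<and>
     (\<forall>l\<in>L. \<forall>l'\<in>L. l \<noteq> l' \<longrightarrow> card (l \<inter> l') \<le> 1)"

definition uniform_system :: "nat \<Rightarrow> 'a set set \<Rightarrow> bool" where
  "uniform_system r L \<longleftrightarrow> (\<forall>l\<in>L. card l = r)"

definition two_packing :: "'a set set \<Rightarrow> 'a set set \<Rightarrow> bool" where
  "two_packing L R \<longleftrightarrow>
     R \<subseteq> L \<and>
     (\<forall>l1\<in>R. \<forall>l2\<in>R. \<forall>l3\<in>R.
        l1 \<noteq> l2 \<longrightarrow> l1 \<noteq> l3 \<longrightarrow> l2 \<noteq> l3 \<longrightarrow> l1 \<inter> l2 \<inter> l3 = {})"

text \<open>
  The maximum is well defined for a linear system: its set of lines is finite, and the empty set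
  is always a 2-packing.
\<close>

definition nu2 :: "'a set set \<Rightarrow> nat" where
  "nu2 L = Max {card R | R. two_packing L R}"

end

theory Submission
  imports Defs
begin

text \<open>
  Let \<open>R\<close> be a maximum 2-packing with \<open>n\<close> lines. Adding its lines one at a time, the \<open>i\<close>-th line
  contributes at least \<open>r - (i - 1)\<close> new points, so \<open>|P| \<ge> n r - n (n - 1) / 2\<close>. Together with
  \<open>|\<L>| \<ge> n\<close> and \<open>n \<le> r + 1\<close> this gives the claim, by cases on the parity of \<open>n\<close>.
\<close>

text \<open>A new line meets each earlier one in at most one point, so it meets their union in at
  most as many points as there are earlier lines. These losses add up to 0 + 1 + ... + (n - 1), the
  binomial coefficient. It stands on the right to avoid truncated subtraction.\<close>

lemma card_Union_ge_of_small_intersections: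
  assumes "finite R"
    and "\<And>l. l \<in> R \<Longrightarrow> finite l \<and> card l = r"
    and "\<And>l m. l \<in> R \<Longrightarrow> m \<in> R \<Longrightarrow> l \<noteq> m \<Longrightarrow> card (l \<inter> m) \<le> 1"
  shows "card R * r \<le> card (\<Union>R) + (card R choose 2)"
  using assms
proof (induction R rule: finite_induct)
  case empty
  then show ?case by simp
next
  case (insert l R)
  have IH: "card R * r \<le> card (\<Union>R) + (card R choose 2)"
    using insert.IH insert.prems by blast
  have "card (l \<inter> \<Union>R) = card (\<Union>m\<in>R. l \<inter> m)"
    by (simp only: Int_Union)
  also have "\<dots> \<le> (\<Sum>m\<in>R. card (l \<inter> m))"
    by (rule card_UN_le[OF insert.hyps(1)])
  also have "\<dots> \<le> (\<Sum>m\<in>R. 1)"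
    using insert.hyps insert.prems(2) by (intro sum_mono) auto
  finally have "card (l \<inter> \<Union>R) \<le> card R" by simp
  moreover have "card l + card (\<Union>R) = card (\<Union>(insert l R)) + card (l \<inter> \<Union>R)"
    using insert.hyps insert.prems(1) card_Un_Int[of l "\<Union>R"] by auto
  moreover have "card l = r" using insert.prems(1) by simp
  ultimately show ?case
    \<comment> \<open>Pascal's rule: the binomial coefficient grows by exactly
      \<open>card R\<close>, the bound on the overlap.\<close>
    using IH insert.hyps by (simp add: numeral_2_eq_2)
qed

lemma nu2_attained:
  assumes "finite L"
  obtains R where "two_packing L R" "card R = nu2 L"
proof -
  let ?S = "{card R | R. two_packing L R}"
  \<comment> \<open>\<open>Max\<close> is known to be attained only on a finite nonempty
    set.\<close>
  have "?S \<subseteq> card ` Pow L" by (auto simp: two_packing_def)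
  then have "finite ?S" using assms finite_subset by blast
  moreover have "two_packing L {}" by (simp add: two_packing_def)
  then have "?S \<noteq> {}" by blast
  ultimately have "nu2 L \<in> ?S" unfolding nu2_def by (rule Max_in)
  then show thesis using that by auto
qed

theorem theorem2p5:
  fixes P :: "'a set" and L :: "'a set set" and r :: nat
  assumes "linear_system P L"
    and "uniform_system r L"
    and "int (nu2 L) - 1 \<le> int r"
  shows "real_of_int \<lceil>real (nu2 L) / 2\<rceil> \<le> (real (card P) + real (card L)) / (real r + 1)"
proof -
  have P: "finite P" "L \<subseteq> Pow P" using assms(1) by (auto simp: linear_system_def)
  then have L: "finite L" using finite_subset by blast
  obtain R where R: "two_packing L R" "card R = nu2 L" using nu2_attained[OF L] .
  define n where "n = nu2 L"
  have RL: "R \<subseteq> L" using R(1) by (simp add: two_packing_def)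
  have "card R * r \<le> card (\<Union>R) + (card R choose 2)"
  proof (rule card_Union_ge_of_small_intersections)
    show "finite R" using RL L finite_subset by blast
    show "finite l \<and> card l = r" if "l \<in> R" for l
      using that RL P assms(2) by (auto simp: uniform_system_def intro: finite_subset)
    show "card (l \<inter> m) \<le> 1" if "l \<in> R" "m \<in> R" "l \<noteq> m" for l m
      using that RL assms(1) unfolding linear_system_def by blast
  qed
  moreover have "card (\<Union>R) \<le> card P"
    using RL P by (intro card_mono) auto
  ultimately have points: "n * r \<le> card P + (n choose 2)"
    using R(2) by (simp add: n_def)
  have lines: "n \<le> card L"
    using card_mono[OF L RL] R(2) by (simp add: n_def)
  have nr: "n \<le> r + 1" using assms(3) by (simp add: n_def)
  define k where "k = (n + 1) div 2"
  have ceil: "\<lceil>real n / 2\<rceil> = int k"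
    unfolding k_def by (rule ceiling_unique) linarith+
  \<comment> \<open>Adding \<open>lines\<close> to \<open>points\<close> bounds n (r + 1) by |P| +
    |L| plus the binomial coefficient. Since n - k is the floor m of n / 2, it remains to bound that
    coefficient by m (r + 1).\<close>
  have "k * (r + 1) + (n choose 2) \<le> n * (r + 1)"
  proof (cases "even n")
    case True
    then obtain m where m: "n = 2 * m" by blast
    have "n choose 2 = m * (n - 1)" by (simp add: choose_two m)
    also have "\<dots> \<le> m * (r + 1)" using nr by (intro mult_le_mono) auto
    finally show ?thesis by (simp add: k_def m algebra_simps)
  next
    case False
    then obtain m where m: "n = 2 * m + 1" by (elim oddE)
    \<comment> \<open>The cofactor of m is now n itself, not n - 1, so \<open>nr\<close> is used in
      full.\<close>
    have "n choose 2 = m * n" by (simp add: choose_two m)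
    also have "\<dots> \<le> m * (r + 1)" using nr by (intro mult_le_mono) auto
    finally show ?thesis by (simp add: k_def m algebra_simps)
  qed
  then have "k * (r + 1) \<le> card P + card L"
    using points lines by simp
  then have "real (k * (r + 1)) \<le> real (card P + card L)"
    by (simp only: of_nat_le_iff)
  then have "real k * (real r + 1) \<le> real (card P) + real (card L)"
    by (simp add: algebra_simps)
  then show ?thesis
    using ceil by (simp add: n_def pos_le_divide_eq)
qed

end
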